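(* Let $k \geq 6$ and $\frac{k}{2} \leq m \leq k-2$. Then $g_1(k,m) \leq \binom{k}{m} - m$; that is, every finite $k$-uniform hypergraph $H$ with $\nu^{(m)}(H) = 1$ satisfies $\tau^{(m)}(H) \leq \binom{k}{m} - m$.
   Context: For a $k$-uniform hypergraph $H$ with vertex set $V$ and $1 \le m \le k-1$: an $m$-matching of $H$ is a set $M$ of edges with $|e \cap e'| < m$ for all distinct $e, e' \in M$; $\nu^{(m)}(H)$ is the maximum size of an $m$-matching. An $m$-cover is a set $C \subseteq \binom{V}{m}$ such that every edge of $H$ contains some member of $C$; $\tau^{(m)}(H)$ is the minimum size of an $m$-cover. $g_1(k,m)$ is the supremum of $\tau^{(m)}(H)/\nu^{(m)}(H)$ over all finite $k$-uniform hypergraphs $H$ with $\nu^{(m)}(H) = 1$. *)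

theory Defs
  imports "HOL-Library.Ramsey" "HOL-Library.Extended_Real"
begin

definition uniform_hypergraph :: "nat \<Rightarrow> 'a set \<Rightarrow> 'a set set \<Rightarrow> bool" where
  "uniform_hypergraph k V E \<longleftrightarrow> finite V \<and> E \<subseteq> [V]\<^bsup>k\<^esup>"

definition m_matching :: "nat \<Rightarrow> 'a set set \<Rightarrow> 'a set set \<Rightarrow> bool" where
  "m_matching m E M \<longleftrightarrow> M \<subseteq> E \<and> (\<forall>e\<in>M. \<forall>e'\<in>M. e \<noteq> e' \<longrightarrow> card (e \<inter> e') < m)"

definition m_cover :: "nat \<Rightarrow> 'a set \<Rightarrow> 'a set set \<Rightarrow> 'a set set \<Rightarrow> bool" where
  "m_cover m V E C \<longleftrightarrow> C \<subseteq> [V]\<^bsup>m\<^esup> \<and> (\<forall>e\<in>E. \<exists>c\<in>C. c \<subseteq> e)"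

text \<open>
  For finite \<open>V\<close> and \<open>E\<close> both sets below are finite. The first contains 0; the second is
  nonempty for a \<open>k\<close>-uniform hypergraph with \<open>m \<le> k\<close>, since all \<open>m\<close>-subsets of \<open>V\<close> form a cover.
\<close>

definition matching_number :: "nat \<Rightarrow> 'a set set \<Rightarrow> nat" where
  "matching_number m E = Max {card M |M. m_matching m E M}"

definition cover_number :: "nat \<Rightarrow> 'a set \<Rightarrow> 'a set set \<Rightarrow> nat" where
  "cover_number m V E = Min {card C |C. m_cover m V E C}"

text \<open>
  Every finite hypergraph is isomorphic to one on a set of natural numbers, so this vertex type
  loses no generality. The supremum is taken in the extended reals, where an unbounded set of
  ratios has supremum \<open>\<infinity>\<close>.
\<close>

definition g1 :: "nat \<Rightarrow> nat \<Rightarrow> ereal" where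
  "g1 k m = Sup {ereal (real (cover_number m V E) / real (matching_number m E)) |V E.
     uniform_hypergraph k (V :: nat set) E \<and> matching_number m E = 1}"

end

theory Submission
  imports Defs
begin

text \<open>
  Fix an edge \<open>e\<close> and start from the cover by all \<open>m\<close>-subsets of \<open>e\<close>. Call an \<open>m\<close>-subset \<open>S\<close> of \<open>e\<close>
  exact if \<open>f \<inter> e = S\<close> for some edge \<open>f\<close>. If at least \<open>m\<close> of the \<open>m\<close>-subsets are not exact, \<open>m\<close> of
  these can be dropped, because an \<open>(m+1)\<close>-subset of \<open>e\<close> has \<open>m+1\<close> subsets of size \<open>m\<close>. Otherwise,
  note that if \<open>f \<inter> e = S\<close>, \<open>h \<inter> e = S'\<close> and \<open>S \<union> S' = e\<close>, then \<open>card (f \<inter> h) \<ge> m\<close> forces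
  \<open>f - e = h - e\<close>; so an exact \<open>S'\<close> makes the edge over \<open>S\<close> unique. Since few sets are not exact, for
  a fixed \<open>w \<in> e\<close> at least \<open>2m\<close> of the sets \<open>S\<close> containing \<open>w\<close> have at most one edge over them.
  Group these \<open>2m\<close> sets into \<open>m\<close> pairs and replace each pair by a single \<open>m\<close>-subset of the
  intersection of the two edges over it; edges meeting \<open>e\<close> in more than \<open>m\<close> points stay covered,
  because an \<open>(m+1)\<close>-set has an \<open>m\<close>-subset avoiding \<open>w\<close>.
\<close>

definition exact :: "'a set set \<Rightarrow> 'a set \<Rightarrow> 'a set \<Rightarrow> bool" where
  "exact E e S \<longleftrightarrow> (\<exists>f\<in>E. f \<inter> e = S)"

text \<open>If \<open>S\<close> is not exact this holds vacuously, so every set that is not light is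
  exact.\<close>

definition light :: "'a set set \<Rightarrow> 'a set \<Rightarrow> 'a set \<Rightarrow> bool" where
  "light E e S \<longleftrightarrow> (\<forall>f\<in>E. \<forall>g\<in>E. f \<inter> e = S \<longrightarrow> g \<inter> e = S \<longrightarrow> f = g)"

section \<open>Counting subsets and binomial estimates\<close>

lemma card_nsets:
  assumes "finite A"
  shows "card ([A]\<^bsup>n\<^esup>) = card A choose n"
proof -
  have "[A]\<^bsup>n\<^esup> = {B. B \<subseteq> A \<and> card B = n}"
    using assms by (auto simp: nsets_def intro: finite_subset)
  then show ?thesis using assms by (simp add: n_subsets)
qed

lemma card_nsets_containing:
  assumes "finite A" "w \<in> A" "0 < n"
  shows "card {S \<in> [A]\<^bsup>n\<^esup>. w \<in> S} = (card A - 1) choose (n - 1)"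
proof -
  have eq: "{S \<in> [A]\<^bsup>n\<^esup>. w \<in> S} = insert w ` [A - {w}]\<^bsup>(n - 1)\<^esup>"
  proof (intro subset_antisym subsetI)
    fix S assume "S \<in> {S \<in> [A]\<^bsup>n\<^esup>. w \<in> S}"
    then have "S - {w} \<in> [A - {w}]\<^bsup>(n - 1)\<^esup>" "S = insert w (S - {w})"
      by (auto simp: nsets_def)
    then show "S \<in> insert w ` [A - {w}]\<^bsup>(n - 1)\<^esup>" by blast
  next
    fix S assume "S \<in> insert w ` [A - {w}]\<^bsup>(n - 1)\<^esup>"
    then obtain R where "S = insert w R" "R \<subseteq> A - {w}" "finite R" "card R = n - 1"
      by (auto simp: nsets_def)
    moreover from this have "w \<notin> R" by blast
    ultimately show "S \<in> {S \<in> [A]\<^bsup>n\<^esup>. w \<in> S}"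
      using assms by (auto simp: nsets_def)
  qed
  have "inj_on (insert w) ([A - {w}]\<^bsup>(n - 1)\<^esup>)"
    by (rule inj_onI) (auto simp: nsets_def)
  then show ?thesis
    using assms by (simp add: eq card_image card_nsets)
qed

lemma le_binomial:
  assumes "0 < j" "j < n"
  shows "n \<le> n choose j"
  using assms
proof (induction n arbitrary: j)
  case (Suc n)
  then obtain i where j: "j = Suc i" using gr0_implies_Suc by blast
  show ?case
  proof (cases "Suc i = n")
    case True
    then show ?thesis using j binomial_symmetric[of j "Suc n"] by simp
  next
    case False
    then have "n \<le> n choose Suc i" "0 < n choose i"
      using Suc j by (auto simp: zero_less_binomial)
    then show ?thesis unfolding j binomial_Suc_Suc by linarith
  qed
qed simp

text \<open>With \<open>n = m\<close>, this bounds the number of \<open>m\<close>-sets through a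
  fixed point of an \<open>(m+2)\<close>-set, the smallest edge size allowed.\<close>

lemma le_binomial_two:
  assumes "3 \<le> n"
  shows "2 * n \<le> (n + 1) choose (n - 1)"
proof -
  have "2 * n \<le> (n + 1) choose 2"
    using assms
  proof (induction n rule: dec_induct)
    case base
    then show ?case by (simp add: choose_two)
  next
    case (step n)
    have "(Suc n + 1) choose 2 = (n + 1) + ((n + 1) choose 2)"
      by (simp add: numeral_2_eq_2)
    then show ?case using step by simp
  qed
  then show ?thesis using assms binomial_symmetric[of 2 "n + 1"] by simp
qed

text \<open>Serves the case \<open>k = 2 * m\<close>: of \<open>3 * m\<close> sets through a point,
  up to \<open>m\<close> may be lost and \<open>2 * m\<close> remain.\<close>

lemma le_binomial_three:
  assumes "3 \<le> n"
  shows "3 * n \<le> (n + 2) choose (n - 1)"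
proof -
  have "3 * n \<le> (n + 2) choose 3"
    using assms
  proof (induction n rule: dec_induct)
    case base
    then show ?case by (simp add: numeral_eq_Suc)
  next
    case (step n)
    have "(Suc n + 2) choose 3 = ((n + 2) choose 2) + ((n + 2) choose 3)"
      by (simp add: numeral_2_eq_2 numeral_3_eq_3)
    moreover have "n + 2 \<le> (n + 2) choose 2" using step by (intro le_binomial) simp_all
    ultimately show ?case using step by simp
  qed
  then show ?thesis using assms binomial_symmetric[of 3 "n + 2"] by simp
qed

section \<open>Cover and matching numbers of finite hypergraphs\<close>

lemma cover_number_le:
  assumes "finite V" "m_cover m V E C"
  shows "cover_number m V E \<le> card C"
proof -
  have "{card C |C. m_cover m V E C} \<subseteq> card ` Pow ([V]\<^bsup>m\<^esup>)"
    by (auto simp: m_cover_def)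
  then have "finite {card C |C. m_cover m V E C}"
    by (rule finite_subset) (simp add: finite_imp_finite_nsets assms)
  then show ?thesis
    unfolding cover_number_def using assms(2) by (intro Min_le) auto
qed

lemma matching_number_one:
  assumes "finite E" "matching_number m E = 1"
  shows "E \<noteq> {}" "\<And>f g. f \<in> E \<Longrightarrow> g \<in> E \<Longrightarrow> f \<noteq> g \<Longrightarrow> m \<le> card (f \<inter> g)"
proof -
  have "{card M |M. m_matching m E M} \<subseteq> card ` Pow E"
    by (auto simp: m_matching_def)
  then have fin: "finite {card M |M. m_matching m E M}"
    by (rule finite_subset) (simp add: assms)
  have "m_matching m E {}" by (simp add: m_matching_def)
  then have "{card M |M. m_matching m E M} \<noteq> {}" by blast
  from Max_in[OF fin this] obtain M where "m_matching m E M" "card M = 1"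
    using assms(2) by (auto simp: matching_number_def)
  then show "E \<noteq> {}" by (auto simp: m_matching_def)
  show "m \<le> card (f \<inter> g)" if "f \<in> E" "g \<in> E" "f \<noteq> g" for f g
  proof (rule ccontr)
    assume "\<not> m \<le> card (f \<inter> g)"
    then have "m_matching m E {f, g}"
      using that by (auto simp: m_matching_def Int_commute)
    then have "card {f, g} \<le> Max {card M |M. m_matching m E M}"
      by (intro Max_ge fin) auto
    then show False using assms(2) that by (simp add: matching_number_def)
  qed
qed

section \<open>Exchanging members of the cover by the \<open>m\<close>-subsets of an edge\<close>

locale intersecting_family =
  fixes k m :: nat and V :: "'a set" and E :: "'a set set"
  assumes finite_V: "finite V"
    and E_sub: "E \<subseteq> [V]\<^bsup>k\<^esup>"
    and inter: "\<And>f g. f \<in> E \<Longrightarrow> g \<in> E \<Longrightarrow> m \<le> card (f \<inter> g)"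
begin

lemma edgeD: "f \<in> E \<Longrightarrow> f \<subseteq> V" "f \<in> E \<Longrightarrow> finite f" "f \<in> E \<Longrightarrow> card f = k"
  using E_sub by (auto simp: nsets_def)

text \<open>The new cover is \<open>[e]^m\<close> with \<open>D\<close> replaced by
  \<open>C\<close>. An edge meeting \<open>e\<close> in exactly \<open>m\<close> points keeps its
  trace or is caught by \<open>hit\<close>; a larger trace contains some \<open>B\<close>, and
  \<open>free\<close> leaves an \<open>m\<close>-subset of it in place.\<close>

lemma cover_by_exchange:
  assumes e: "e \<in> E" and D: "D \<subseteq> [e]\<^bsup>m\<^esup>" and C: "C \<subseteq> [V]\<^bsup>m\<^esup>"
    and free: "\<And>B. B \<in> [e]\<^bsup>(Suc m)\<^esup> \<Longrightarrow> \<exists>S\<in>[B]\<^bsup>m\<^esup>. S \<notin> D"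
    and hit: "\<And>f. f \<in> E \<Longrightarrow> f \<inter> e \<in> D \<Longrightarrow> \<exists>c\<in>C. c \<subseteq> f"
  shows "cover_number m V E + card D \<le> (k choose m) + card C"
proof -
  note fin = edgeD(2)[OF e]
  let ?C = "([e]\<^bsup>m\<^esup> - D) \<union> C"
  have "m_cover m V E ?C"
    unfolding m_cover_def
  proof (intro conjI ballI)
    show "?C \<subseteq> [V]\<^bsup>m\<^esup>"
      using C edgeD(1)[OF e] by (auto simp: nsets_def)
    fix f assume f: "f \<in> E"
    show "\<exists>c\<in>?C. c \<subseteq> f"
    proof (cases "card (f \<inter> e) = m")
      case True
      then have "f \<inter> e \<in> [e]\<^bsup>m\<^esup>" using fin by (auto simp: nsets_def)
      then show ?thesis using hit[OF f] by blast
    next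
      case False
      then have "Suc m \<le> card (f \<inter> e)" using inter[OF f e] by simp
      then obtain B where B: "B \<subseteq> f \<inter> e" "card B = Suc m" "finite B"
        by (rule obtain_subset_with_card_n)
      then have "B \<in> [e]\<^bsup>(Suc m)\<^esup>" by (auto simp: nsets_def)
      from free[OF this] obtain S where "S \<in> [B]\<^bsup>m\<^esup>" "S \<notin> D" by blast
      then show ?thesis using B by (intro bexI[of _ S]) (auto simp: nsets_def)
    qed
  qed
  then have "cover_number m V E \<le> card ?C" by (rule cover_number_le[OF finite_V])
  also have "\<dots> \<le> card ([e]\<^bsup>m\<^esup> - D) + card C" by (rule card_Un_le)
  finally show ?thesis
    using D card_mono[OF finite_imp_finite_nsets[OF fin] D] finite_subset[OF D]
    by (simp add: card_Diff_subset card_nsets finite_imp_finite_nsets fin edgeD(3)[OF e])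
qed

lemma cover_number_if_many_not_exact:
  assumes e: "e \<in> E" and N: "m \<le> card {S \<in> [e]\<^bsup>m\<^esup>. \<not> exact E e S}"
  shows "cover_number m V E + m \<le> k choose m"
proof -
  obtain D where D: "D \<subseteq> {S \<in> [e]\<^bsup>m\<^esup>. \<not> exact E e S}" "card D = m" "finite D"
    by (rule obtain_subset_with_card_n[OF N])
  have "cover_number m V E + card D \<le> (k choose m) + card ({} :: 'a set set)"
  proof (rule cover_by_exchange[OF e])
    fix B assume "B \<in> [e]\<^bsup>(Suc m)\<^esup>"
    then have "finite B" "card B = Suc m" by (auto simp: nsets_def)
    then have "card ([B]\<^bsup>m\<^esup>) = Suc m" by (simp add: card_nsets)
    then have "\<not> [B]\<^bsup>m\<^esup> \<subseteq> D"
      using card_mono[OF D(3), of "[B]\<^bsup>m\<^esup>"] D(2) by linarith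
    then show "\<exists>S\<in>[B]\<^bsup>m\<^esup>. S \<notin> D" by blast
  next
    show "D \<subseteq> [e]\<^bsup>m\<^esup>" using D(1) by blast
    fix f assume "f \<in> E" "f \<inter> e \<in> D"
    then have "\<not> exact E e (f \<inter> e)" using D(1) by blast
    then show "\<exists>c\<in>{}. c \<subseteq> f" using \<open>f \<in> E\<close> unfolding exact_def by blast
  qed simp
  then show ?thesis using D by simp
qed

lemma light_pair:
  assumes e: "e \<in> E" and "light E e S" "light E e S'"
  shows "\<exists>c\<in>[V]\<^bsup>m\<^esup>. \<forall>f\<in>E. f \<inter> e = S \<or> f \<inter> e = S' \<longrightarrow> c \<subseteq> f"
proof -
  have *: "\<exists>h\<in>E. \<forall>f\<in>E. f \<inter> e = S \<longrightarrow> f = h" if "light E e S" for S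
  proof (cases "\<exists>h\<in>E. h \<inter> e = S")
    case True
    then show ?thesis using that unfolding light_def by metis
  next
    case False
    \<comment> \<open>No edge lies over \<open>S\<close>, so any edge will do as \<open>h\<close>;
      \<open>e\<close> is a default value.\<close>
    then show ?thesis using e by metis
  qed
  obtain f where f: "f \<in> E" "\<And>h. h \<in> E \<Longrightarrow> h \<inter> e = S \<Longrightarrow> h = f"
    using *[OF assms(2)] by metis
  obtain g where g: "g \<in> E" "\<And>h. h \<in> E \<Longrightarrow> h \<inter> e = S' \<Longrightarrow> h = g"
    using *[OF assms(3)] by metis
  obtain c where c: "c \<subseteq> f \<inter> g" "card c = m" "finite c"
    by (rule obtain_subset_with_card_n[OF inter[OF f(1) g(1)]])
  have "c \<in> [V]\<^bsup>m\<^esup>"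
    using c edgeD(1)[OF f(1)] by (auto simp: nsets_def)
  moreover have "c \<subseteq> h" if "h \<in> E" "h \<inter> e = S \<or> h \<inter> e = S'" for h
    using that f(2)[of h] g(2)[of h] c(1) by blast
  ultimately show ?thesis by blast
qed

lemma cover_number_if_many_light:
  assumes e: "e \<in> E" and L: "2 * m \<le> card {S \<in> [e]\<^bsup>m\<^esup>. w \<in> S \<and> light E e S}"
  shows "cover_number m V E + m \<le> k choose m"
proof -
  obtain D where D: "D \<subseteq> {S \<in> [e]\<^bsup>m\<^esup>. w \<in> S \<and> light E e S}" "card D = 2 * m" "finite D"
    by (rule obtain_subset_with_card_n[OF L])
  obtain A where A: "A \<subseteq> D" "card A = m" "finite A"
    using obtain_subset_with_card_n[of m D] D by auto
  \<comment> \<open>The bijection \<open>p\<close> pairs each set of \<open>A\<close> with one of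
    \<open>D - A\<close>; \<open>2 * m\<close> sets leave the cover and at most \<open>m\<close>
    enter.\<close>
  have "card (D - A) = card A" using A D by (simp add: card_Diff_subset)
  then obtain p where p: "bij_betw p A (D - A)"
    using finite_same_card_bij[of A "D - A"] A D by auto
  have "\<exists>c\<in>[V]\<^bsup>m\<^esup>. \<forall>f\<in>E. f \<inter> e = S \<or> f \<inter> e = p S \<longrightarrow> c \<subseteq> f" if "S \<in> A" for S
    using that A D p by (intro light_pair[OF e]) (auto dest: bij_betwE)
  then obtain c where c: "\<And>S. S \<in> A \<Longrightarrow> c S \<in> [V]\<^bsup>m\<^esup>"
    "\<And>S f. S \<in> A \<Longrightarrow> f \<in> E \<Longrightarrow> f \<inter> e = S \<or> f \<inter> e = p S \<Longrightarrow> c S \<subseteq> f"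
    by metis
  have "cover_number m V E + card D \<le> (k choose m) + card (c ` A)"
  proof (rule cover_by_exchange[OF e])
    fix B assume B: "B \<in> [e]\<^bsup>(Suc m)\<^esup>"
    then have "m \<le> card (B - {w})" by (auto simp: nsets_def card_Diff_singleton_if)
    then obtain S where "S \<subseteq> B - {w}" "card S = m" "finite S"
      by (rule obtain_subset_with_card_n)
    then show "\<exists>S\<in>[B]\<^bsup>m\<^esup>. S \<notin> D"
      using D by (intro bexI[of _ S]) (auto simp: nsets_def)
  next
    fix f assume f: "f \<in> E" "f \<inter> e \<in> D"
    have "D = A \<union> p ` A" using p A by (auto simp: bij_betw_def)
    then obtain S where "S \<in> A" "f \<inter> e = S \<or> f \<inter> e = p S" using f by blast
    then show "\<exists>d\<in>c ` A. d \<subseteq> f" using c(2) f by blast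
  qed (use D c in auto)
  then show ?thesis using D A card_image_le[OF A(3), of c] by simp
qed

section \<open>Exact sets force light ones\<close>

lemma edge_over_eq:
  assumes "e \<in> E" "f \<in> E" "h \<in> E" and S: "card (f \<inter> e) = m" and S': "card (h \<inter> e) = m"
    and un: "(f \<inter> e) \<union> (h \<inter> e) = e"
  shows "f - e = h - e"
proof -
  note fin = edgeD(2)[OF assms(1)] edgeD(2)[OF assms(2)] edgeD(2)[OF assms(3)]
  note card = edgeD(3)[OF assms(1)] edgeD(3)[OF assms(2)] edgeD(3)[OF assms(3)]
  have split: "card X = card (X \<inter> e) + card (X - e)" if "finite X" for X
    using that by (metis Int_Diff_Un Int_Diff_disjoint card_Un_disjoint finite_Diff finite_Int)
  have "card e + card (f \<inter> h \<inter> e) = m + m"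
    \<comment> \<open>The two traces cover \<open>e\<close>, so they share only
      \<open>2 * m - k\<close> points. Hence \<open>f\<close> and \<open>h\<close> share at least
      \<open>k - m\<close> points outside \<open>e\<close>, which is all that either has
      there.\<close>
    using card_Un_Int[of "f \<inter> e" "h \<inter> e"] fin S S' un by (simp add: Int_ac)
  moreover have "m \<le> card (f \<inter> h \<inter> e) + card (f \<inter> h - e)"
    using split[of "f \<inter> h"] inter[OF assms(2,3)] fin by simp
  moreover have "card (f - e) = k - m" "card (h - e) = k - m"
    using split[of f] split[of h] fin card S S' by simp_all
  ultimately have "card (f - e) \<le> card (f \<inter> h - e)" "card (h - e) \<le> card (f \<inter> h - e)"
    using card by simp_all
  then have "f \<inter> h - e = f - e" "f \<inter> h - e = h - e"
    using fin by (intro card_seteq; blast)+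
  then show ?thesis by simp
qed

lemma light_if_exact:
  assumes e: "e \<in> E" and S: "S \<in> [e]\<^bsup>m\<^esup>" and S': "S' \<in> [e]\<^bsup>m\<^esup>" "exact E e S'" and un: "S \<union> S' = e"
  shows "light E e S"
  unfolding light_def
proof (intro ballI impI)
  obtain h where h: "h \<in> E" "h \<inter> e = S'" using S'(2) by (auto simp: exact_def)
  have *: "f - e = h - e" if "f \<in> E" "f \<inter> e = S" for f
    using that S S'(1) un h by (intro edge_over_eq[OF e]) (auto simp: nsets_def)
  fix f g assume "f \<in> E" "g \<in> E" "f \<inter> e = S" "g \<inter> e = S"
  then show "f = g" using *[of f] *[of g] by blast
qed

text \<open>Contrapositive of \<open>light_if_exact\<close>: each \<open>e - R\<close> completes
  \<open>S\<close> to \<open>e\<close>. The image form allows these sets to be counted.\<close>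

lemma not_exact_if_not_light:
  assumes e: "e \<in> E" and S: "S \<in> [e]\<^bsup>m\<^esup>" "\<not> light E e S" and "m \<le> k"
  shows "(\<lambda>R. e - R) ` [S]\<^bsup>(k - m)\<^esup> \<subseteq> {S \<in> [e]\<^bsup>m\<^esup>. \<not> exact E e S}"
proof (rule image_subsetI)
  fix R assume R: "R \<in> [S]\<^bsup>(k - m)\<^esup>"
  have "R \<subseteq> S" "finite R" "card R = k - m" "S \<subseteq> e"
    using R S by (auto simp: nsets_def)
  then have "e - R \<in> [e]\<^bsup>m\<^esup>" "S \<union> (e - R) = e"
    using edgeD(2,3)[OF e] \<open>m \<le> k\<close> by (auto simp: nsets_def card_Diff_subset)
  then show "e - R \<in> {S \<in> [e]\<^bsup>m\<^esup>. \<not> exact E e S}"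
    using light_if_exact[OF e S(1)] S(2) by blast
qed

text \<open>Here \<open>0 < k - m < m\<close>, so one set that is not light would already yield
  \<open>m choose (k - m)\<close>, hence at least \<open>m\<close>, sets that are not exact.\<close>

lemma all_light:
  assumes e: "e \<in> E" and "m < k" "k < 2 * m"
    and N: "card {S \<in> [e]\<^bsup>m\<^esup>. \<not> exact E e S} < m" and S: "S \<in> [e]\<^bsup>m\<^esup>"
  shows "light E e S"
proof (rule ccontr)
  assume "\<not> light E e S"
  then have sub: "(\<lambda>R. e - R) ` [S]\<^bsup>(k - m)\<^esup> \<subseteq> {S \<in> [e]\<^bsup>m\<^esup>. \<not> exact E e S}"
    using not_exact_if_not_light[OF e S] assms by simp
  have "inj_on (\<lambda>R. e - R) ([S]\<^bsup>(k - m)\<^esup>)"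
    using S by (intro inj_onI) (auto simp: nsets_def)
  then have "card ((\<lambda>R. e - R) ` [S]\<^bsup>(k - m)\<^esup>) = card ([S]\<^bsup>(k - m)\<^esup>)"
    by (rule card_image)
  also have "\<dots> = m choose (k - m)"
  proof -
    have "finite S" "card S = m" using S by (auto simp: nsets_def)
    then show ?thesis by (simp add: card_nsets)
  qed
  finally have "card ((\<lambda>R. e - R) ` [S]\<^bsup>(k - m)\<^esup>) = m choose (k - m)" .
  moreover have "m \<le> m choose (k - m)" using assms by (intro le_binomial) auto
  ultimately show False
    using card_mono[OF _ sub] N finite_imp_finite_nsets[OF edgeD(2)[OF e]] by simp
qed

text \<open>Now \<open>k - m = m\<close>, so \<open>R = S\<close> is the only choice and a set that
  is not light excludes only its complement; complementation is injective.\<close>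

lemma few_not_light:
  assumes e: "e \<in> E" and "k = 2 * m"
  shows "card {S \<in> [e]\<^bsup>m\<^esup>. \<not> light E e S} \<le> card {S \<in> [e]\<^bsup>m\<^esup>. \<not> exact E e S}"
proof (rule card_inj_on_le)
  show "inj_on (\<lambda>S. e - S) {S \<in> [e]\<^bsup>m\<^esup>. \<not> light E e S}"
    by (intro inj_onI) (auto simp: nsets_def)
  show "(\<lambda>S. e - S) ` {S \<in> [e]\<^bsup>m\<^esup>. \<not> light E e S} \<subseteq> {S \<in> [e]\<^bsup>m\<^esup>. \<not> exact E e S}"
  proof (rule image_subsetI)
    fix S assume S: "S \<in> {S \<in> [e]\<^bsup>m\<^esup>. \<not> light E e S}"
    then have "S \<in> [S]\<^bsup>(k - m)\<^esup>" using assms by (auto simp: nsets_def)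
    then show "e - S \<in> {S \<in> [e]\<^bsup>m\<^esup>. \<not> exact E e S}"
      using not_exact_if_not_light[OF e, of S] S assms by auto
  qed
  show "finite {S \<in> [e]\<^bsup>m\<^esup>. \<not> exact E e S}"
    using finite_imp_finite_nsets[OF edgeD(2)[OF e]] by simp
qed

lemma cover_number_bound:
  assumes e: "e \<in> E" and k: "6 \<le> k" "k \<le> 2 * m" "m + 2 \<le> k"
  shows "cover_number m V E + m \<le> k choose m"
proof (cases "m \<le> card {S \<in> [e]\<^bsup>m\<^esup>. \<not> exact E e S}")
  case True
  then show ?thesis by (rule cover_number_if_many_not_exact[OF e])
next
  case False
  note fin = edgeD(2)[OF e] and card = edgeD(3)[OF e]
  obtain w where w: "w \<in> e" using card k by fastforce
  let ?W = "{S \<in> [e]\<^bsup>m\<^esup>. w \<in> S}" and ?L = "{S \<in> [e]\<^bsup>m\<^esup>. w \<in> S \<and> light E e S}"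
  have W: "card ?W = (k - 1) choose (m - 1)"
    using card_nsets_containing[OF fin w] k card by simp
  have "2 * m \<le> card ?L"
  proof (cases "k = 2 * m")
    case True
    let ?N = "{S \<in> [e]\<^bsup>m\<^esup>. \<not> light E e S}"
    have finL: "finite ?L" "finite ?N"
      using finite_imp_finite_nsets[OF fin] by simp_all
    \<comment> \<open>From \<open>6 \<le> k = 2 * m\<close> follow \<open>3 \<le> m\<close> and
      \<open>m + 2 \<le> k - 1\<close>. Fewer than \<open>m\<close> sets fail to be light.\<close>
    have "3 * m \<le> (m + 2) choose (m - 1)" using k by (intro le_binomial_three) simp
    also have "\<dots> \<le> (k - 1) choose (m - 1)"
      using k True by (intro binomial_right_mono) simp
    also have "\<dots> \<le> card (?L \<union> ?N)"
      unfolding W[symmetric] using finL by (intro card_mono) auto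
    also have "\<dots> \<le> card ?L + card ?N" by (rule card_Un_le)
    finally show ?thesis using few_not_light[OF e True] False by simp
  next
    case False': False
    \<comment> \<open>For \<open>k < 2 * m\<close> every \<open>m\<close>-subset of \<open>e\<close>
      is light, so all sets through \<open>w\<close> count, and
      \<open>m + 1 \<le> k - 1\<close>.\<close>
    have "2 * m \<le> (m + 1) choose (m - 1)" using k by (intro le_binomial_two) simp
    also have "\<dots> \<le> (k - 1) choose (m - 1)"
      using k by (intro binomial_right_mono) simp
    also have "?W = ?L" using all_light[OF e] False False' k by auto
    then have "(k - 1) choose (m - 1) = card ?L" using W by simp
    finally show ?thesis .
  qed
  then show ?thesis by (rule cover_number_if_many_light[OF e])
qed

end

section \<open>Transfer to hypergraphs with matching number one\<close>

lemma cover_number_le_binomial_minus: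
  assumes "6 \<le> k" "k \<le> 2 * m" "m + 2 \<le> k"
    and H: "uniform_hypergraph k V E" and \<nu>: "matching_number m E = 1"
  shows "real (cover_number m V E) \<le> real (k choose m) - real m"
proof -
  have V: "finite V" "E \<subseteq> [V]\<^bsup>k\<^esup>" using H by (auto simp: uniform_hypergraph_def)
  then have "finite E" using finite_imp_finite_nsets finite_subset by blast
  note E = matching_number_one[OF this \<nu>]
  interpret intersecting_family k m V E
  proof
    fix f g assume fg: "f \<in> E" "g \<in> E"
    show "m \<le> card (f \<inter> g)"
    proof (cases "f = g")
      case True
      \<comment> \<open>The locale assumption includes \<open>f = g\<close>, where it amounts to
        \<open>m \<le> k\<close>.\<close>
      then show ?thesis using fg V assms by (auto simp: nsets_def)
    qed (use E fg in blast)
  qed (use V in auto)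
  obtain e where "e \<in> E" using E by blast
  then have "cover_number m V E + m \<le> k choose m"
    using cover_number_bound assms by blast
  then show ?thesis by linarith
qed

theorem theorem3:
  fixes k m :: nat
  assumes "k \<ge> 6" and "real k / 2 \<le> real m" and "m \<le> k - 2"
  shows "g1 k m \<le> ereal (real (k choose m) - real m) \<and>
    (\<forall>(V :: 'a set) E. uniform_hypergraph k V E \<and> matching_number m E = 1
        \<longrightarrow> real (cover_number m V E) \<le> real (k choose m) - real m)"
proof -
  have k: "6 \<le> k" "k \<le> 2 * m" "m + 2 \<le> k" using assms by linarith+
  have "g1 k m \<le> ereal (real (k choose m) - real m)"
    unfolding g1_def
  proof (rule Sup_least)
    fix x :: ereal
    assume "x \<in> {ereal (real (cover_number m V E) / real (matching_number m E)) |V E.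
      uniform_hypergraph k (V :: nat set) E \<and> matching_number m E = 1}"
    \<comment> \<open>The denominator is 1, so the ratio is the cover number itself.\<close>
    then show "x \<le> ereal (real (k choose m) - real m)"
      using cover_number_le_binomial_minus[OF k] by auto
  qed
  then show ?thesis using cover_number_le_binomial_minus[OF k] by blast
qed

end
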